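(* Let $d \geq 2$ be an integer. For $r \in [0,d]$ let $H_r^+ = \{\mathbf{x} \in \mathbb{R}^d : x_1 + \cdots + x_d \geq r\}$ and define $V_d^+ : [0,d] \to [0,1]$ by $V_d^+(r) = \mathrm{vol}\left([0,1]^d \cap H_r^+\right)$. Set $f(0) = 0$ and, for integers $1 \leq k \leq d$, $$f(k) := \frac{1}{d!} \sum_{j=0}^{k-1} (-1)^j \binom{d}{j} (k-j)^d .$$ For arbitrary $V \in [0,1]$, let the integer $1 \leq k \leq d$ be such that $f(k-1) \leq V \leq f(k)$. Then the parameter $r \in [0,d]$ of the positive half space $H_r^+$ such that $V_d^+(r) = V$ is a solution of the polynomial equation $$\frac{1}{d!} \sum_{j=0}^{k-1} (-1)^j \binom{d}{j} (d-j-r)^d = V .$$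
   Context: $\mathrm{vol}$ denotes $d$-dimensional Lebesgue measure. *)

theory Defs
  imports "HOL-Analysis.Analysis"
begin

definition half_space_pos :: "real \<Rightarrow> (real ^ 'n) set" where
  "half_space_pos r = {x. (\<Sum>i\<in>UNIV. x $ i) \<ge> r}"

(* The dimension is CARD('n); 1 is the all-ones vector, so the box is the unit cube. *)
definition V_pos :: "'n::finite itself \<Rightarrow> real \<Rightarrow> real" where
  "V_pos _ r = measure lebesgue (cbox 0 1 \<inter> half_space_pos r :: (real ^ 'n) set)"

(* For k = 0 the sum is empty, so the value is 0. *)
definition vol_threshold :: "nat \<Rightarrow> nat \<Rightarrow> real" where
  "vol_threshold d k =
     1 / fact d * (\<Sum>j<k. (- 1) ^ j * real (d choose j) * (real k - real j) ^ d)"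

end

theory Submission
  imports Defs
begin

text \<open>
  The cap of the unit cube above the level \<open>r\<close> has volume \<open>F (d - r)\<close>, where \<open>F\<close> is the cumulative
  distribution function of the sum of \<open>d\<close> independent uniform variables on \<open>[0,1]\<close> (the Irwin--Hall
  distribution), because \<open>x \<mapsto> 1 - x\<close> preserves the cube and its volume.  In closed form
    \<open>F s = 1 / d! * (\<Sum>j\<le>d. (-1)^j * (d choose j) * (s - j)\<^sub>+^d)\<close>,
  where \<open>y\<^sub>+^d\<close> is the truncated power.  This formula follows by induction on the dimension: slicing the
  cube along one coordinate integrates the \<open>d\<close>-dimensional formula over a unit interval, each
  truncated power becomes a difference of two truncated powers of degree \<open>d + 1\<close>, and Pascal's rule
  collects them (\<open>has_integral_irwin_hall\<close>, \<open>emeasure_cube_cap_PiM\<close>).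

  On \<open>[k - 1, k]\<close> only the terms with \<open>j < k\<close> survive the truncation
  (\<open>irwin_hall_eq_partial_sum\<close>).  Hence the threshold at \<open>k\<close> is the value \<open>F k\<close>, and the polynomial
  of the theorem is \<open>F (d - r)\<close> as long as \<open>k - 1 \<le> d - r \<le> k\<close>.  So it remains to see that
  \<open>F\<close> maps \<open>[0,d]\<close> bijectively and monotonically onto \<open>[0,1]\<close>.  Continuity is visible from the
  closed form.  Strict monotonicity is seen geometrically: between two levels the cube contains a
  nonempty open set (\<open>V_pos_strict_antimono\<close>).
\<close>

section \<open>Truncated powers and the Irwin--Hall distribution function\<close>

text \<open>
  For \<open>n = 0\<close> this is the indicator function of the nonnegative reals, whereas \<open>max 0 x ^ 0\<close> would be
  constantly \<open>1\<close>.  The base case of the induction on the dimension, a cube that is a single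
  point, needs the former.
\<close>

definition trunc_power :: "nat \<Rightarrow> real \<Rightarrow> real" where
  "trunc_power n x = (if 0 \<le> x then x ^ n else 0)"

definition irwin_hall :: "nat \<Rightarrow> real \<Rightarrow> real" where
  "irwin_hall n s =
     1 / fact n * (\<Sum>j\<le>n. (- 1) ^ j * real (n choose j) * trunc_power n (s - real j))"

lemma trunc_power_Suc_eq_max: "trunc_power (Suc n) x = max 0 x ^ Suc n"
  by (simp add: trunc_power_def max_def)

lemma continuous_on_trunc_power_Suc [continuous_intros]:
  assumes "continuous_on S f"
  shows "continuous_on S (\<lambda>x. trunc_power (Suc n) (f x))"
  unfolding trunc_power_Suc_eq_max by (intro continuous_intros assms)

lemma continuous_on_irwin_hall:
  assumes "n > 0"
  shows "continuous_on S (irwin_hall n)"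
proof -
  obtain m where "n = Suc m" using assms by (cases n) auto
  then show ?thesis
    unfolding irwin_hall_def by (auto intro!: continuous_intros)
qed

lemma has_vector_derivative_trunc_power:
  assumes "x \<noteq> 0"
  shows "(trunc_power (Suc n) has_vector_derivative real (Suc n) * trunc_power n x) (at x)"
proof (cases "x > 0")
  case True
  have "((\<lambda>y. y ^ Suc n) has_vector_derivative real (Suc n) * x ^ n) (at x)"
    using DERIV_pow[of "Suc n" x] by (simp add: has_real_derivative_iff_has_vector_derivative)
  then have "(trunc_power (Suc n) has_vector_derivative real (Suc n) * x ^ n) (at x)"
    by (rule has_vector_derivative_transform_within_open[of _ _ _ "{0<..}"])
      (use True in \<open>auto simp: trunc_power_def\<close>)
  then show ?thesis using True by (simp add: trunc_power_def)
next
  case False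
  with assms have "x < 0" by simp
  have "((\<lambda>y. 0 :: real) has_vector_derivative 0) (at x)" by simp
  then have "(trunc_power (Suc n) has_vector_derivative 0) (at x)"
    by (rule has_vector_derivative_transform_within_open[of _ _ _ "{..<0}"])
      (use \<open>x < 0\<close> in \<open>auto simp: trunc_power_def\<close>)
  then show ?thesis using \<open>x < 0\<close> by (simp add: trunc_power_def)
qed

lemma has_integral_trunc_power:
  "((\<lambda>t. trunc_power n (a + t)) has_integral
     (trunc_power (Suc n) (a + 1) - trunc_power (Suc n) a) / real (Suc n)) {0..1}"
proof -
  have "((\<lambda>t. real (Suc n) * trunc_power n (a + t)) has_integral
     trunc_power (Suc n) (a + 1) - trunc_power (Suc n) (a + 0)) {0..1}"
  \<comment> \<open>The kink of the antiderivative at \<open>0\<close> sits at \<open>t = - a\<close>.\<close>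
  proof (rule fundamental_theorem_of_calculus_interior_strong[of "{- a}"])
    fix t :: real
    assume "t \<in> {0<..<1} - {- a}"
    then have "a + t \<noteq> 0" by auto
    have "((\<lambda>t. a + t) has_vector_derivative 1) (at t)"
      by (auto intro!: derivative_eq_intros)
    from vector_diff_chain_at[OF this has_vector_derivative_trunc_power[OF \<open>a + t \<noteq> 0\<close>, of n]]
    show "((\<lambda>t. trunc_power (Suc n) (a + t)) has_vector_derivative
        real (Suc n) * trunc_power n (a + t)) (at t)"
      by (simp add: o_def)
  qed (auto intro!: continuous_intros)
  from has_integral_mult_right[OF this, of "1 / real (Suc n)"] show ?thesis
    by simp
qed

text \<open>Pascal's rule, in the form of a summation by parts against an arbitrary sequence.\<close>

lemma alternating_binomial_sum_Suc:
  fixes P :: "nat \<Rightarrow> real"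
  shows "(\<Sum>j\<le>n. (- 1) ^ j * real (n choose j) * (P j - P (Suc j))) =
    (\<Sum>j\<le>Suc n. (- 1) ^ j * real (Suc n choose j) * P j)"
proof -
  have "(\<Sum>j\<le>Suc n. (- 1) ^ j * real (Suc n choose j) * P j) =
      P 0 + (\<Sum>j\<le>n. (- 1) ^ Suc j * real (n choose Suc j) * P (Suc j))
        + (\<Sum>j\<le>n. (- 1) ^ Suc j * real (n choose j) * P (Suc j))"
    by (subst sum.atMost_Suc_shift) (simp add: sum.distrib[symmetric] algebra_simps)
  also have "P 0 + (\<Sum>j\<le>n. (- 1) ^ Suc j * real (n choose Suc j) * P (Suc j)) =
      (\<Sum>j\<le>Suc n. (- 1) ^ j * real (n choose j) * P j)"
    by (subst sum.atMost_Suc_shift) simp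
  also have "\<dots> = (\<Sum>j\<le>n. (- 1) ^ j * real (n choose j) * P j)"
    by simp
  finally show ?thesis
    by (simp add: sum.distrib[symmetric] sum_subtractf[symmetric] algebra_simps)
qed

text \<open>The convolution with the uniform distribution on \<open>[0,1]\<close> raises the dimension by one.\<close>

lemma has_integral_irwin_hall:
  "((\<lambda>t. irwin_hall n (s + t)) has_integral irwin_hall (Suc n) (s + 1)) {0..1}"
proof -
  define P where "P j = trunc_power (Suc n) (s + 1 - real j)" for j
  have "((\<lambda>t. 1 / fact n *
          (\<Sum>j\<le>n. (- 1) ^ j * real (n choose j) * trunc_power n (s - real j + t))) has_integral
        1 / fact n * (\<Sum>j\<le>n. (- 1) ^ j * real (n choose j) *
          ((trunc_power (Suc n) (s - real j + 1) - trunc_power (Suc n) (s - real j)) / real (Suc n))))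
      {0..1}"
    by (intro has_integral_mult_right has_integral_sum has_integral_trunc_power) auto
  also have "(\<lambda>t. 1 / fact n *
      (\<Sum>j\<le>n. (- 1) ^ j * real (n choose j) * trunc_power n (s - real j + t))) =
      (\<lambda>t. irwin_hall n (s + t))"
    by (simp add: irwin_hall_def algebra_simps)
  also have "1 / fact n * (\<Sum>j\<le>n. (- 1) ^ j * real (n choose j) *
        ((trunc_power (Suc n) (s - real j + 1) - trunc_power (Suc n) (s - real j)) / real (Suc n))) =
      1 / fact (Suc n) * (\<Sum>j\<le>n. (- 1) ^ j * real (n choose j) * (P j - P (Suc j)))"
    by (simp add: P_def sum_distrib_left field_simps)
  also have "\<dots> = irwin_hall (Suc n) (s + 1)"
    unfolding alternating_binomial_sum_Suc by (simp add: irwin_hall_def P_def)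
  finally show ?thesis .
qed

text \<open>
  The bounds on \<open>s\<close> make the truncation visible: terms with \<open>j < k\<close> are powers of nonnegative
  numbers, all others vanish.  At \<open>s = k\<close> this also evaluates the distribution function at an integer.
\<close>

lemma irwin_hall_eq_partial_sum:
  assumes "n > 0" "k \<le> n" "real k - 1 \<le> s" "s \<le> real k"
  shows "irwin_hall n s =
    1 / fact n * (\<Sum>j<k. (- 1) ^ j * real (n choose j) * (s - real j) ^ n)"
proof -
  have "(\<Sum>j\<le>n. (- 1) ^ j * real (n choose j) * trunc_power n (s - real j)) =
      (\<Sum>j<k. (- 1) ^ j * real (n choose j) * (s - real j) ^ n)"
  proof (rule sum.mono_neutral_cong_right)
    show "\<forall>j\<in>{..n} - {..<k}. (- 1) ^ j * real (n choose j) * trunc_power n (s - real j) = 0"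
      using assms by (auto simp: trunc_power_def)
    show "(- 1) ^ j * real (n choose j) * trunc_power n (s - real j) =
        (- 1) ^ j * real (n choose j) * (s - real j) ^ n" if "j \<in> {..<k}" for j
    proof -
      from that have "real j + 1 \<le> real k" by auto
      then show ?thesis using assms by (simp add: trunc_power_def)
    qed
  qed (use assms in auto)
  then show ?thesis by (simp add: irwin_hall_def)
qed

lemma vol_threshold_eq_irwin_hall:
  assumes "d > 0" "k \<le> d"
  shows "vol_threshold d k = irwin_hall d (real k)"
  using irwin_hall_eq_partial_sum[of d k "real k"] assms by (simp add: vol_threshold_def)

section \<open>The volume of a cap of the unit cube\<close>

text \<open>
  The cap is taken in a product of copies of the real line over an arbitrary finite index set, since
  an induction on the dimension is possible there but not over types.  Nonnegativity of the value is
  part of the induction because \<open>ennreal\<close> would hide a negative one.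
\<close>

lemma emeasure_cube_cap_PiM:
  fixes A :: "'a set"
  assumes "finite A"
  shows "0 \<le> irwin_hall (card A) (real (card A) - r) \<and>
    emeasure (Pi\<^sub>M A (\<lambda>_. lborel))
      ({x. (\<forall>i\<in>A. 0 \<le> x i \<and> x i \<le> 1) \<and> r \<le> sum x A} \<inter> space (Pi\<^sub>M A (\<lambda>_. lborel))) =
    ennreal (irwin_hall (card A) (real (card A) - r))"
  using assms
proof (induction arbitrary: r rule: finite_induct)
  case empty
  show ?case by (auto simp: PiM_empty irwin_hall_def trunc_power_def)
next
  case (insert b A r)
  define cap :: "'a set \<Rightarrow> real \<Rightarrow> ('a \<Rightarrow> real) set" where
    "cap B u = {x. (\<forall>i\<in>B. 0 \<le> x i \<and> x i \<le> 1) \<and> u \<le> sum x B}" for B u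
  let ?M = "\<lambda>B :: 'a set. (Pi\<^sub>M B (\<lambda>_. lborel :: real measure))"
  have meas [measurable]: "cap B u \<inter> space (?M B) \<in> sets (?M B)" if "finite B" for B u
  proof -
    have "cap B u \<inter> space (?M B) =
        Pi\<^sub>E B (\<lambda>_. {0..1}) \<inter> (\<lambda>x. sum x B) -` {u..} \<inter> space (?M B)"
      by (auto simp: cap_def space_PiM PiE_iff)
    also have "\<dots> \<in> sets (?M B)"
      using that by measurable
    finally show ?thesis .
  qed
  have slice: "x(b := y) \<in> cap (insert b A) r \<longleftrightarrow> y \<in> {0..1} \<and> x \<in> cap A (r - y)" for x y
  proof -
    have "(\<Sum>i\<in>A. (x(b := y)) i) = sum x A"
      using insert.hyps by (intro sum.cong) auto
    then show ?thesis using insert.hyps by (auto simp: cap_def)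
  qed
  have IH: "0 \<le> irwin_hall (card A) (real (card A) - r + y)"
    "emeasure (?M A) (cap A (r - y) \<inter> space (?M A)) =
       ennreal (irwin_hall (card A) (real (card A) - r + y))" for y
    using insert.IH[of "r - y"] unfolding cap_def by (simp_all add: algebra_simps)
  interpret product_sigma_finite "\<lambda>_. lborel :: real measure"
    by standard
  note integral = has_integral_irwin_hall[of "card A" "real (card A) - r"]
  have "emeasure (?M (insert b A)) (cap (insert b A) r \<inter> space (?M (insert b A))) =
      (\<integral>\<^sup>+ x. indicator (cap (insert b A) r \<inter> space (?M (insert b A))) x \<partial>?M (insert b A))"
    using insert.hyps by (subst nn_integral_indicator) auto
  also have "\<dots> = (\<integral>\<^sup>+ y. \<integral>\<^sup>+ x. indicator (cap (insert b A) r \<inter> space (?M (insert b A)))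
                    (x(b := y)) \<partial>?M A \<partial>lborel)"
    using insert.hyps by (intro product_nn_integral_insert_rev) auto
  also have "\<dots> = (\<integral>\<^sup>+ y. \<integral>\<^sup>+ x. indicator {0..1} y * indicator (cap A (r - y) \<inter> space (?M A)) x
                    \<partial>?M A \<partial>lborel)"
  proof (intro nn_integral_cong)
    fix y :: real and x :: "'a \<Rightarrow> real"
    assume "x \<in> space (?M A)"
    then have "x(b := y) \<in> space (?M (insert b A))"
      by (auto simp: space_PiM PiE_def extensional_def)
    with \<open>x \<in> space (?M A)\<close>
    show "indicator (cap (insert b A) r \<inter> space (?M (insert b A))) (x(b := y)) =
        indicator {0..1} y * (indicator (cap A (r - y) \<inter> space (?M A)) x :: ennreal)"
      by (simp add: indicator_def slice del: atLeastAtMost_iff)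
  qed
  also have "\<dots> = (\<integral>\<^sup>+ y. indicator {0..1} y * emeasure (?M A) (cap A (r - y) \<inter> space (?M A)) \<partial>lborel)"
    using insert.hyps by (simp add: nn_integral_cmult)
  also have "\<dots> = (\<integral>\<^sup>+ y. ennreal (indicator {0..1} y * irwin_hall (card A) (real (card A) - r + y)) \<partial>lborel)"
    by (intro nn_integral_cong) (simp add: IH(2) indicator_def)
  also have "\<dots> = ennreal (irwin_hall (Suc (card A)) (real (card A) - r + 1))"
    using nn_integral_has_integral_lebesgue[OF IH(1) integral] .
  finally show ?case
    using insert.hyps has_integral_nonneg[OF integral IH(1)]
    by (simp add: cap_def algebra_simps)
qed

text \<open>Lebesgue measure on a Euclidean space is the image of the product measure over its basis.\<close>

lemma emeasure_lborel_cube_cap: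
  "emeasure lborel
     {x::'a::euclidean_space. (\<forall>b\<in>Basis. 0 \<le> x \<bullet> b \<and> x \<bullet> b \<le> 1) \<and> r \<le> (\<Sum>b\<in>Basis. x \<bullet> b)} =
     ennreal (irwin_hall DIM('a) (real DIM('a) - r))"
  (is "emeasure lborel ?S = _")
proof -
  have [measurable]: "?S \<in> sets borel" by measurable
  let ?M = "Pi\<^sub>M Basis (\<lambda>b::'a. lborel :: real measure)"
  have "emeasure lborel ?S = emeasure (distr ?M borel (\<lambda>f. \<Sum>b\<in>Basis. f b *\<^sub>R b)) ?S"
    by (subst lborel_eq) simp
  also have "\<dots> = emeasure ?M
      ({y. (\<forall>b\<in>Basis. 0 \<le> y b \<and> y b \<le> 1) \<and> r \<le> sum y Basis} \<inter> space ?M)"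
    by (subst emeasure_distr) (auto intro!: arg_cong[where f = "emeasure ?M"])
  also have "\<dots> = ennreal (irwin_hall DIM('a) (real DIM('a) - r))"
    using emeasure_cube_cap_PiM[of "Basis :: 'a set" r] by simp
  finally show ?thesis .
qed

lemma sum_Basis_cart: "(\<Sum>b\<in>Basis. (x :: real ^ 'n) \<bullet> b) = (\<Sum>i\<in>UNIV. x $ i)"
proof -
  have "(Basis :: (real ^ 'n) set) = (\<lambda>i. axis i 1) ` UNIV"
    by (auto simp: Basis_vec_def)
  then have "(\<Sum>b\<in>Basis. x \<bullet> b) = (\<Sum>b\<in>(\<lambda>i. axis i 1) ` UNIV. x \<bullet> b)" by simp
  also have "\<dots> = (\<Sum>i\<in>UNIV. x $ i)"
    by (subst sum.reindex) (auto simp: inj_on_def axis_eq_axis inner_axis)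
  finally show ?thesis .
qed

lemma closed_half_space_pos: "closed (half_space_pos r :: (real ^ 'n) set)"
  unfolding half_space_pos_def by (intro closed_Collect_le continuous_intros)

lemma V_pos_eq_irwin_hall: "V_pos TYPE('n::finite) r = irwin_hall CARD('n) (real CARD('n) - r)"
proof -
  let ?S = "cbox 0 1 \<inter> half_space_pos r :: (real ^ 'n) set"
  have "(1 :: real ^ 'n) \<bullet> b = 1" if "b \<in> Basis" for b
    using that by (auto simp: Basis_vec_def inner_axis)
  then have "?S = {x. (\<forall>b\<in>Basis. 0 \<le> x \<bullet> b \<and> x \<bullet> b \<le> 1) \<and> r \<le> (\<Sum>b\<in>Basis. x \<bullet> b)}"
    unfolding half_space_pos_def sum_Basis_cart by (auto simp: mem_box)
  then have "emeasure lborel ?S = ennreal (irwin_hall CARD('n) (real CARD('n) - r))"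
    using emeasure_lborel_cube_cap[where 'a = "real ^ 'n", of r] by simp
  moreover have "?S \<in> sets lborel"
    by (simp add: borel_closed closed_Int closed_half_space_pos)
  moreover have "0 \<le> irwin_hall CARD('n) (real CARD('n) - r)"
    using emeasure_cube_cap_PiM[of "UNIV :: 'n set" r] by simp
  ultimately show ?thesis
    by (simp add: V_pos_def measure_def)
qed

section \<open>Monotonicity of the cap volume\<close>

lemma V_pos_0: "V_pos TYPE('n::finite) 0 = 1"
proof -
  have "cbox 0 1 \<inter> half_space_pos 0 = (cbox 0 1 :: (real ^ 'n) set)"
    by (auto simp: half_space_pos_def mem_box_cart intro!: sum_nonneg)
  moreover have "measure lebesgue (cbox 0 1 :: (real ^ 'n) set) = 1"
    using content_cbox_cart[of 0 "1 :: real ^ 'n"] by (simp add: interval_ne_empty_cart)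
  ultimately show ?thesis by (simp add: V_pos_def)
qed

text \<open>
  The diagonal point whose coordinate sum lies halfway between the two levels is interior to the cube,
  so the slab between the levels contains a nonempty open set, which has positive volume.
\<close>

lemma V_pos_strict_antimono:
  assumes "0 \<le> r" "r < r'" "r' \<le> real CARD('n)"
  shows "V_pos TYPE('n::finite) r' < V_pos TYPE('n) r"
proof -
  let ?C = "\<lambda>u. cbox 0 1 \<inter> half_space_pos u :: (real ^ 'n) set"
  define U :: "(real ^ 'n) set" where
    "U = box 0 1 \<inter> {x. r < (\<Sum>i\<in>UNIV. x $ i)} \<inter> {x. (\<Sum>i\<in>UNIV. x $ i) < r'}"
  have lm: "?C u \<in> lmeasurable" for u
    by (intro lmeasurable_compact compact_Int_closed compact_cbox closed_half_space_pos)
  have "open U"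
    unfolding U_def by (intro open_Int open_box open_Collect_less continuous_intros)
  moreover have "U \<noteq> {}"
  proof -
    define c where "c = (r + r') / (2 * real CARD('n))"
    have "0 < c" "c < 1" "real CARD('n) * c = (r + r') / 2"
      using assms by (auto simp: c_def field_simps)
    then have "(\<chi> i. c) \<in> U" using assms by (simp add: U_def mem_box_cart)
    then show ?thesis by blast
  qed
  ultimately have "\<not> negligible U" by (rule open_not_negligible)
  moreover have "U \<subseteq> ?C r - ?C r'"
    using box_subset_cbox[of 0 "1 :: real ^ 'n"] by (auto simp: U_def half_space_pos_def)
  ultimately have "\<not> negligible (?C r - ?C r')" using negligible_subset by blast
  moreover have "?C r - ?C r' \<in> lmeasurable" by (intro fmeasurable.Diff lm)
  ultimately have "measure lebesgue (?C r - ?C r') \<noteq> 0"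
    by (simp add: negligible_iff_measure)
  moreover have "measure lebesgue (?C r - ?C r') = measure lebesgue (?C r) - measure lebesgue (?C r')"
    using assms by (intro measurable_measure_Diff lm fmeasurableD) (auto simp: half_space_pos_def)
  moreover have "0 \<le> measure lebesgue (?C r - ?C r')" by simp
  ultimately show ?thesis by (simp add: V_pos_def)
qed

lemma irwin_hall_strict_mono:
  assumes "0 \<le> s" "s < s'" "s' \<le> real CARD('n::finite)"
  shows "irwin_hall CARD('n) s < irwin_hall CARD('n) s'"
  using V_pos_strict_antimono[where 'n = 'n, of "real CARD('n) - s'" "real CARD('n) - s"] assms
  by (simp add: V_pos_eq_irwin_hall)

section \<open>The level of a cap of given volume\<close>

theorem theorem1:
  fixes d :: nat and V :: real
  assumes "d = CARD('n::finite)" and "d \<ge> 2"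
    and "V \<in> {0..1}"
  shows "(\<exists>k\<in>{1..d}. vol_threshold d (k - 1) \<le> V \<and> V \<le> vol_threshold d k) \<and>
    (\<exists>!r. r \<in> {0..real d} \<and> V_pos TYPE('n) r = V) \<and>
    (\<forall>k\<in>{1..d}. \<forall>r\<in>{0..real d}.
       vol_threshold d (k - 1) \<le> V \<longrightarrow> V \<le> vol_threshold d k \<longrightarrow> V_pos TYPE('n) r = V \<longrightarrow>
       1 / fact d * (\<Sum>j<k. (- 1) ^ j * real (d choose j) * (real d - real j - r) ^ d) = V)"
proof -
  have d: "d > 0" using assms by simp
  have less: "irwin_hall d s < irwin_hall d s'" if "0 \<le> s" "s < s'" "s' \<le> real d" for s s'
    using irwin_hall_strict_mono[where 'n = 'n] that assms(1) by simp
  have le_iff: "irwin_hall d s \<le> irwin_hall d s' \<longleftrightarrow> s \<le> s'"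
    if "s \<in> {0..real d}" "s' \<in> {0..real d}" for s s'
    using less[of s s'] less[of s' s] that by (cases s s' rule: linorder_cases) auto
  have V_pos: "V_pos TYPE('n) r = irwin_hall d (real d - r)" for r
    using V_pos_eq_irwin_hall[where 'n = 'n] assms(1) by simp
  have "irwin_hall d 0 = 0"
    using irwin_hall_eq_partial_sum[of d 0 0] d by simp
  moreover have "irwin_hall d (real d) = 1"
    using V_pos[of 0] V_pos_0[where 'n = 'n] by simp
  ultimately obtain s where s: "0 \<le> s" "s \<le> real d" "irwin_hall d s = V"
    using IVT'[of "irwin_hall d" 0 V "real d"] continuous_on_irwin_hall[OF d] assms(3) by auto

  have "\<exists>k\<in>{1..d}. vol_threshold d (k - 1) \<le> V \<and> V \<le> vol_threshold d k"
  proof -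
    \<comment> \<open>The maximum only matters for \<open>s = 0\<close>, where the ceiling is not a valid index.\<close>
    define k where "k = max 1 (nat \<lceil>s\<rceil>)"
    have k: "k \<in> {1..d}" "real (k - 1) \<le> s" "s \<le> real k"
      using s d by (auto simp: k_def max_def of_nat_diff) linarith+
    then have "irwin_hall d (real (k - 1)) \<le> V" "V \<le> irwin_hall d (real k)"
      using le_iff[of "real (k - 1)" s] le_iff[of s "real k"] s by auto
    then show ?thesis using k d by (intro bexI[of _ k]) (auto simp: vol_threshold_eq_irwin_hall)
  qed
  moreover have "\<exists>!r. r \<in> {0..real d} \<and> V_pos TYPE('n) r = V"
  proof (rule ex1I[of _ "real d - s"])
    fix r assume r: "r \<in> {0..real d} \<and> V_pos TYPE('n) r = V"
    then have "irwin_hall d (real d - r) = irwin_hall d s" using s V_pos by simp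
    then have "real d - r = s"
      using le_iff[of "real d - r" s] le_iff[of s "real d - r"] r s by auto
    then show "r = real d - s" by simp
  qed (use s V_pos in auto)
  moreover have "1 / fact d * (\<Sum>j<k. (- 1) ^ j * real (d choose j) * (real d - real j - r) ^ d) = V"
    if k: "k \<in> {1..d}" and r: "r \<in> {0..real d}" and V: "V_pos TYPE('n) r = V"
      and low: "vol_threshold d (k - 1) \<le> V" and high: "V \<le> vol_threshold d k" for k r
  proof -
    have "irwin_hall d (real (k - 1)) \<le> irwin_hall d (real d - r)"
      "irwin_hall d (real d - r) \<le> irwin_hall d (real k)"
      using low high k d V V_pos by (auto simp: vol_threshold_eq_irwin_hall)
    then have "real (k - 1) \<le> real d - r" "real d - r \<le> real k"
      using le_iff[of "real (k - 1)" "real d - r"] le_iff[of "real d - r" "real k"] k r by auto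
    then have "irwin_hall d (real d - r) =
        1 / fact d * (\<Sum>j<k. (- 1) ^ j * real (d choose j) * (real d - r - real j) ^ d)"
      using irwin_hall_eq_partial_sum[of d k "real d - r"] k d by (simp add: of_nat_diff)
    then show ?thesis using V V_pos by (simp add: algebra_simps)
  qed
  ultimately show ?thesis by blast
qed

end
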